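(* Let $\mathcal{S}=(H;E_1,E_2,E_3)$ be a system of three subspaces in a Hilbert space $H$. Suppose that $E_1\wedge E_2=0$, $E_1\vee E_2=H$ and $E_2\subsetneq E_3$, and assume that $E_3/E_2$ is finite-dimensional. Then the following hold. (i) If $E_3\neq E_3\cap(E_1+E_2)$, then there exist subspaces $E_1',E_2',E_3'$ and $N_2$ of $H$ such that (1) $H\supset E_1'\oplus_{alg}E_3'\oplus_{alg}N_2$ (dense); (2) $(E_1'\vee E_3';E_1',E_2',E_3')$ forms a pentagon (with $E_3'\supset E_2'$); (3) $E_1=\overline{E_1'\oplus_{alg}N_2}$, $E_2=E_2'$ and $E_3=\overline{E_3'\oplus_{alg}N_2}$. Moreover, $(N_2;N_2,0,N_2)$ is a distributive part. (ii) If $E_3=E_3\cap(E_1+E_2)$, then there exist subspaces $N_1,N_2$ and $M_1$ of $H$ such that $H\supset N_1\oplus_{alg}N_2\oplus_{alg}M_1$ (dense), $E_1=N_2+M_1$, $E_2=N_1$ and $E_3=N_1+N_2$.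
   Context: Hilbert spaces are complex; "subspace" means closed linear subspace. For subspaces $A,B$ of $H$: $A+B$ is the (not necessarily closed) linear sum, $A\vee B:=\overline{A+B}$, $A\wedge B:=A\cap B$. A system of three subspaces $(H;E_1,E_2,E_3)$ is a Hilbert space $H$ with three closed subspaces. The notation $A_1\oplus_{alg}\cdots\oplus_{alg}A_m$ denotes the algebraic direct sum, i.e. the linear sum $A_1+\cdots+A_m$ together with the assertion that $A_1,\dots,A_m$ are linearly independent ($x_1+\cdots+x_m=0$ with $x_i\in A_i$ implies all $x_i=0$). "$H\supset X$ (dense)" means that $X$ is a linear subspace of $H$ with $\overline X=H$. A system $(H';E_1',E_2',E_3')$ forms a pentagon (with $E_3'\supset E_2'$) if $E_1'\vee E_2'=H'$, $E_1'\wedge E_3'=0$, $E_3'\supset E_2'$, $E_3'\neq E_2'$, and each $E_i'\neq H'$, $E_i'\neq 0$. A distributive part is a system whose space is an algebraic direct sum $S\oplus_{alg}N_1\oplus_{alg}N_2\oplus_{alg}N_3\oplus_{alg}M_1\oplus_{alg}M_2\oplus_{alg}M_3\oplus_{alg}L$ of eight (possibly zero) components, where the first subspace is made of the components $S,N_2,N_3,M_1$, the second of $S,N_1,N_3,M_2$, and the third of $S,N_1,N_2,M_3$. *)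

theory Defs
  imports "HOL-Analysis.Analysis"
begin

text \<open>
  Complex Hilbert spaces, with the inner product linear in its first argument. The class
  extends \<^class>\<open>real_inner\<close>, whose inner product is the real part of the complex one; this
  ties the norm and topology to \<open>cinner\<close> and makes \<open>cinner\<close> positive definite.
\<close>

class complex_hilbert_space = real_inner + complete_space +
  fixes scaleC :: "complex \<Rightarrow> 'a \<Rightarrow> 'a" (infixr "*\<^sub>C" 75)
    and cinner :: "'a \<Rightarrow> 'a \<Rightarrow> complex"
  assumes scaleC_add_right: "a *\<^sub>C (x + y) = a *\<^sub>C x + a *\<^sub>C y"
    and scaleC_add_left: "(a + b) *\<^sub>C x = a *\<^sub>C x + b *\<^sub>C x"
    and scaleC_scaleC: "a *\<^sub>C b *\<^sub>C x = (a * b) *\<^sub>C x"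
    and scaleR_scaleC: "r *\<^sub>R x = complex_of_real r *\<^sub>C x"
    and cinner_commute: "cinner x y = cnj (cinner y x)"
    and cinner_add_left: "cinner (x + y) z = cinner x z + cinner y z"
    and cinner_scaleC_left: "cinner (a *\<^sub>C x) y = a * cinner x y"
    and inner_eq_Re_cinner: "inner x y = Re (cinner x y)"

instantiation complex :: complex_hilbert_space
begin

definition scaleC_complex :: "complex \<Rightarrow> complex \<Rightarrow> complex"
  where "scaleC_complex a x = a * x"

definition cinner_complex :: "complex \<Rightarrow> complex \<Rightarrow> complex"
  where "cinner_complex x y = x * cnj y"

instance
  by standard
    (simp_all add: scaleC_complex_def cinner_complex_def inner_complex_def algebra_simps
      scaleR_conv_of_real)

end

global_interpretation complex_vector:
  vector_space "scaleC :: complex \<Rightarrow> 'a \<Rightarrow> 'a::complex_hilbert_space"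
  defines csubspace = complex_vector.subspace
proof
  fix x :: 'a
  show "1 *\<^sub>C x = x"
    using scaleR_scaleC[of 1 x] by simp
qed (simp_all add: scaleC_add_right scaleC_add_left scaleC_scaleC)

definition closed_csubspace :: "'a::complex_hilbert_space set \<Rightarrow> bool"
  where "closed_csubspace A \<longleftrightarrow> csubspace A \<and> closed A"

text \<open>The join \<open>A \<or> B\<close>. Here and below, \<open>A + B\<close> is the elementwise sum of sets.\<close>

definition closed_sum :: "'a::complex_hilbert_space set \<Rightarrow> 'a set \<Rightarrow> 'a set"
  where "closed_sum A B = closure (A + B)"

text \<open>
  An algebraic direct sum of \<open>A\<^sub>1, \<dots>, A\<^sub>m\<close> is the set \<open>A\<^sub>1 + \<dots> + A\<^sub>m\<close> together with the
  assertion \<open>alg_independent [A\<^sub>1, \<dots>, A\<^sub>m]\<close>.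
\<close>

definition alg_independent :: "'a::complex_hilbert_space set list \<Rightarrow> bool"
  where "alg_independent As \<longleftrightarrow>
    (\<forall>xs. list_all2 (\<in>) xs As \<and> sum_list xs = 0 \<longrightarrow> (\<forall>x\<in>set xs. x = 0))"

definition three_subspaces ::
    "'a::complex_hilbert_space set \<Rightarrow> 'a set \<Rightarrow> 'a set \<Rightarrow> 'a set \<Rightarrow> bool"
  where "three_subspaces H E1 E2 E3 \<longleftrightarrow>
    closed_csubspace H \<and> closed_csubspace E1 \<and> closed_csubspace E2 \<and> closed_csubspace E3 \<and>
    E1 \<subseteq> H \<and> E2 \<subseteq> H \<and> E3 \<subseteq> H"

text \<open>The quotient space as a set of cosets.\<close>

definition coset :: "'a::complex_hilbert_space \<Rightarrow> 'a set \<Rightarrow> 'a set"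
  where "coset x B = (\<lambda>b. x + b) ` B"

definition quotient_space :: "'a::complex_hilbert_space set \<Rightarrow> 'a set \<Rightarrow> 'a set set"
  where "quotient_space A B = (\<lambda>x. coset x B) ` A"

text \<open>
  \<open>A/B\<close> is spanned by finitely many cosets \<open>f + B\<close>. The linear operations of \<open>A/B\<close> are those
  on representatives, so \<open>\<Sum>f. c f *\<^sub>C (f + B)\<close> is the coset of \<open>\<Sum>f. c f *\<^sub>C f\<close>. Meant for
  linear subspaces \<open>B \<subseteq> A\<close>.
\<close>

definition finite_dim_quotient :: "'a::complex_hilbert_space set \<Rightarrow> 'a set \<Rightarrow> bool"
  where "finite_dim_quotient A B \<longleftrightarrow>
    (\<exists>F. finite F \<and> F \<subseteq> A \<and>
      (\<forall>q \<in> quotient_space A B. \<exists>c. q = coset (\<Sum>f\<in>F. c f *\<^sub>C f) B))"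

definition pentagon ::
    "'a::complex_hilbert_space set \<Rightarrow> 'a set \<Rightarrow> 'a set \<Rightarrow> 'a set \<Rightarrow> bool"
  where "pentagon H E1 E2 E3 \<longleftrightarrow>
    three_subspaces H E1 E2 E3 \<and>
    closed_sum E1 E2 = H \<and> E1 \<inter> E3 = {0} \<and> E2 \<subseteq> E3 \<and> E3 \<noteq> E2 \<and>
    E1 \<noteq> H \<and> E2 \<noteq> H \<and> E3 \<noteq> H \<and> E1 \<noteq> {0} \<and> E2 \<noteq> {0} \<and> E3 \<noteq> {0}"

definition distributive_part ::
    "'a::complex_hilbert_space set \<Rightarrow> 'a set \<Rightarrow> 'a set \<Rightarrow> 'a set \<Rightarrow> bool"
  where "distributive_part H E1 E2 E3 \<longleftrightarrow>
    three_subspaces H E1 E2 E3 \<and>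
    (\<exists>S N1 N2 N3 M1 M2 M3 L.
      (\<forall>A \<in> {S, N1, N2, N3, M1, M2, M3, L}. closed_csubspace A) \<and>
      alg_independent [S, N1, N2, N3, M1, M2, M3, L] \<and>
      H = S + N1 + N2 + N3 + M1 + M2 + M3 + L \<and>
      E1 = S + N2 + N3 + M1 \<and>
      E2 = S + N1 + N3 + M2 \<and>
      E3 = S + N1 + N2 + M3)"

end

theory Submission
  imports Defs
begin

text \<open>
  Everything is governed by the overlap \<open>N = E1 \<inter> E3\<close>. It meets \<open>E2\<close> only in \<open>0\<close>, so it embeds
  into \<open>E3/E2\<close> and is finite-dimensional. Hence \<open>N\<close> has a closed complement \<open>D\<close> in \<open>E1\<close>.

  If \<open>E3 \<subseteq> E1 + E2\<close>, the modular law gives \<open>E3 = E2 + N\<close>, and \<open>E2\<close>, \<open>N\<close>, \<open>D\<close> are the three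
  components: the system is distributive up to closure.

  Otherwise take \<open>E1' = D\<close>, \<open>E2' = E2\<close> and let \<open>E3'\<close> be a complement of \<open>N\<close> in \<open>E3\<close> that contains
  \<open>E2\<close>. The choice is delicate, because a pentagon needs \<open>D \<or> E2 = D \<or> E3'\<close>, so \<open>E3'\<close> has to lie in
  \<open>K = D \<or> E2\<close>. Now \<open>K + N\<close> contains the dense \<open>E1 + E2\<close>, and it is closed because \<open>N\<close> is
  finite-dimensional; so \<open>K + N\<close> is the whole space. Each of the finitely many vectors that span \<open>E3\<close>
  modulo \<open>E2\<close> can therefore be shifted into \<open>K\<close> by a vector of \<open>N\<close>, which keeps it in \<open>E3\<close>, and a
  complement is chosen inside the span of \<open>E2\<close> and the shifted vectors. Being a finite-dimensional
  enlargement of \<open>E2\<close>, it is closed. The degenerate cases that a pentagon excludes would each force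
  \<open>E3 \<subseteq> E1 + E2\<close>.

  Two tools carry the argument: adding a finite-dimensional space to a closed subspace keeps it closed
  (\<open>closed_csubspace_plus_cspan_finite\<close>), and closed complements exist both of a finite-dimensional
  subspace (\<open>closed_complement_of_finite_span\<close>) and above a given subspace of finite codimension
  (\<open>closed_complement_above\<close>).
\<close>

section \<open>Elementary sums\<close>

abbreviation cspan :: "'a::complex_hilbert_space set \<Rightarrow> 'a set"
  where "cspan \<equiv> complex_vector.span"

lemma csubspace_imp_subspace: "csubspace A \<Longrightarrow> subspace A"
  by (simp add: subspace_def scaleR_scaleC complex_vector.subspace_0 complex_vector.subspace_add
      complex_vector.subspace_scale)

lemma plus_eq_Collect: "A + B = {x + y | x y. x \<in> A \<and> y \<in> B}"
  by (auto simp: set_plus_def)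

lemma plus_singleton_zero [simp]:
  fixes A :: "'a::comm_monoid_add set"
  shows "A + {0} = A" "{0} + A = A"
  by (simp_all flip: set_zero)

lemma csubspace_plus: "csubspace A \<Longrightarrow> csubspace B \<Longrightarrow> csubspace (A + B)"
  unfolding plus_eq_Collect by (rule complex_vector.subspace_sums)

lemma cspan_insert_plus: "cspan (insert b B) = cspan {b} + cspan B"
  using complex_vector.span_Un[of "{b}" B] by (auto simp: set_plus_def)

lemma subset_plus_left: "csubspace B \<Longrightarrow> A \<subseteq> A + B"
  by (metis add.right_neutral complex_vector.subspace_0 set_plus_intro subsetI)

lemma subset_plus_right: "csubspace A \<Longrightarrow> B \<subseteq> A + B"
  by (metis add.left_neutral complex_vector.subspace_0 set_plus_intro subsetI)

lemma plus_subset_csubspace: "A \<subseteq> C \<Longrightarrow> B \<subseteq> C \<Longrightarrow> csubspace C \<Longrightarrow> A + B \<subseteq> C"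
  by (auto elim!: set_plus_elim intro: complex_vector.subspace_add)

section \<open>Systems of subspaces\<close>

lemma alg_independent_pairI:
  assumes "csubspace B" "A \<inter> B = {0}"
  shows "alg_independent [A, B]"
proof -
  have "a = 0 \<and> b = 0" if "a \<in> A" "b \<in> B" "a + b = 0" for a b
  proof -
    have "a = - b"
      using that(3) by (simp add: eq_neg_iff_add_eq_0)
    then have "a \<in> A \<inter> B"
      using that assms(1) by (simp add: complex_vector.subspace_neg)
    then show ?thesis
      using assms(2) that(3) by auto
  qed
  then show ?thesis
    by (auto simp: alg_independent_def list_all2_Cons2)
qed

lemma alg_independent_tripleI:
  assumes "\<And>a b c. a \<in> A \<Longrightarrow> b \<in> B \<Longrightarrow> c \<in> C \<Longrightarrow> a + b + c = 0 \<Longrightarrow> a = 0 \<and> b = 0 \<and> c = 0"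
  shows "alg_independent [A, B, C]"
  using assms by (auto simp: alg_independent_def list_all2_Cons2 add.assoc)

lemma distributive_part_N2_only:
  assumes "closed_csubspace N"
  shows "distributive_part N N {0} N"
proof -
  have zero: "closed_csubspace ({0} :: 'a set)"
    by (simp add: closed_csubspace_def)
  have indep: "alg_independent [{0}, {0}, N, {0}, {0}, {0}, {0}, {0}]"
    by (auto simp: alg_independent_def list_all2_Cons2)
  show ?thesis
    unfolding distributive_part_def three_subspaces_def
  proof (intro conjI)
    show "{0} \<subseteq> N"
      using assms by (simp add: closed_csubspace_def complex_vector.subspace_0)
    show "\<exists>S N1 N2 N3 M1 M2 M3 L. (\<forall>A\<in>{S, N1, N2, N3, M1, M2, M3, L}. closed_csubspace A) \<and>
        alg_independent [S, N1, N2, N3, M1, M2, M3, L] \<and>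
        N = S + N1 + N2 + N3 + M1 + M2 + M3 + L \<and> N = S + N2 + N3 + M1 \<and>
        {0} = S + N1 + N3 + M2 \<and> N = S + N1 + N2 + M3"
      using assms zero indep
      by (intro exI[of _ "{0}"] exI[of _ N] exI[of _ "{0}"] conjI) simp_all
  qed (use assms zero in auto)
qed

section \<open>Closures\<close>

lemma bounded_linear_scaleC: "bounded_linear (\<lambda>x :: 'a::complex_hilbert_space. c *\<^sub>C x)"
proof (rule bounded_linear_intro[where K = "cmod c"])
  fix x y :: 'a and r :: real
  show "c *\<^sub>C (x + y) = c *\<^sub>C x + c *\<^sub>C y"
    by (rule scaleC_add_right)
  show "c *\<^sub>C (r *\<^sub>R x) = r *\<^sub>R (c *\<^sub>C x)"
    by (simp add: scaleR_scaleC scaleC_scaleC mult.commute)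
  have "cinner (c *\<^sub>C x) (c *\<^sub>C x) = (c * cnj c) * cinner x x"
    by (metis cinner_commute cinner_scaleC_left complex_cnj_mult mult.assoc)
  then have "inner (c *\<^sub>C x) (c *\<^sub>C x) = (cmod c)\<^sup>2 * inner x x"
    by (simp add: inner_eq_Re_cinner flip: complex_norm_square of_real_power)
  then show "norm (c *\<^sub>C x) \<le> norm x * cmod c"
    by (simp add: norm_eq_sqrt_inner real_sqrt_mult mult.commute)
qed

lemma closed_csubspace_closure:
  assumes "csubspace S"
  shows "closed_csubspace (closure S)"
proof -
  have "x + y \<in> closure S" if "x \<in> closure S" "y \<in> closure S" for x y
  proof -
    have "x + y \<in> closure (S + S)"
      using closure_sum[of S S] that by blast
    then show ?thesis
      using closure_mono[OF plus_subset_csubspace[of S S S]] assms by blast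
  qed
  moreover have "c *\<^sub>C x \<in> closure S" if "x \<in> closure S" for c x
  proof -
    have "c *\<^sub>C x \<in> closure ((\<lambda>x. c *\<^sub>C x) ` S)"
      using closure_bounded_linear_image_subset[OF bounded_linear_scaleC] that by blast
    then show ?thesis
      using closure_mono[of "(\<lambda>x. c *\<^sub>C x) ` S" S] complex_vector.subspace_scale[OF assms]
      by blast
  qed
  ultimately show ?thesis
    using assms closure_subset[of S] complex_vector.subspace_0[OF assms]
    by (auto simp: closed_csubspace_def complex_vector.subspace_def)
qed

section \<open>Finite-dimensional enlargements of closed subspaces\<close>

text \<open>
  If \<open>v\<close> has distance \<open>d > 0\<close> from \<open>S\<close>, then \<open>\<bar>r\<bar> * d \<le> norm (a + r *\<^sub>R v)\<close> for \<open>a \<in> S\<close>. So the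
  coefficient of \<open>v\<close> depends continuously on the vector, and along a convergent sequence both
  components converge.
\<close>

lemma closed_plus_span_singleton:
  fixes S :: "'a::real_normed_vector set"
  assumes "closed S" "subspace S"
  shows "closed (S + span {v})"
proof (cases "v \<in> S")
  case True
  then have "span {v} \<subseteq> S"
    using assms(2) by (simp add: span_minimal)
  then have "S + span {v} = S"
    using assms(2) set_plus_intro[OF _ span_0[of "{v}"], of _ S]
    by (auto elim!: set_plus_elim intro: subspace_add)
  then show ?thesis
    using assms(1) by simp
next
  case False
  define d where "d = infdist v S"
  have "d > 0"
    unfolding d_def using assms False subspace_0[OF assms(2)]
    by (intro infdist_pos_not_in_closed) auto
  have bound: "\<bar>r\<bar> * d \<le> norm (a + r *\<^sub>R v)" if "a \<in> S" for a r
  proof (cases "r = 0")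
    case False
    have "- (a /\<^sub>R r) \<in> S"
      using that assms(2) by (simp add: subspace_neg subspace_scale)
    then have "d \<le> dist v (- (a /\<^sub>R r))"
      unfolding d_def by (rule infdist_le)
    then have "\<bar>r\<bar> * d \<le> \<bar>r\<bar> * norm (v + a /\<^sub>R r)"
      by (simp add: dist_norm mult_left_mono)
    also have "\<dots> = norm (r *\<^sub>R (v + a /\<^sub>R r))"
      by simp
    also have "r *\<^sub>R (v + a /\<^sub>R r) = a + r *\<^sub>R v"
      using False by (simp add: algebra_simps)
    finally show ?thesis .
  qed simp
  show ?thesis
    unfolding closed_sequential_limits
  proof (intro allI impI, elim conjE)
    fix x l assume x: "\<forall>n. x n \<in> S + span {v}" and lim: "x \<longlonglongrightarrow> l"
    have "\<exists>a r. a \<in> S \<and> x n = a + r *\<^sub>R v" for n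
      using x[rule_format, of n] by (auto elim!: set_plus_elim simp: span_singleton)
    then obtain a r where ar: "\<And>n. a n \<in> S" "\<And>n. x n = a n + r n *\<^sub>R v"
      by metis
    have "Cauchy r"
    proof (rule metric_CauchyI)
      fix e :: real assume "e > 0"
      then have "e * d > 0"
        using \<open>d > 0\<close> by simp
      then obtain M where M: "\<And>m n. m \<ge> M \<Longrightarrow> n \<ge> M \<Longrightarrow> dist (x m) (x n) < e * d"
        using metric_CauchyD[OF LIMSEQ_imp_Cauchy[OF lim]] by blast
      have "dist (r m) (r n) < e" if "m \<ge> M" "n \<ge> M" for m n
      proof -
        have "\<bar>r m - r n\<bar> * d \<le> norm ((a m - a n) + (r m - r n) *\<^sub>R v)"
          by (rule bound) (use ar assms in \<open>simp add: subspace_diff\<close>)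
        also have "\<dots> = dist (x m) (x n)"
          by (simp add: ar dist_norm algebra_simps)
        also have "\<dots> < e * d"
          using M that by blast
        finally show ?thesis
          using \<open>d > 0\<close> by (simp add: dist_real_def)
      qed
      then show "\<exists>M. \<forall>m\<ge>M. \<forall>n\<ge>M. dist (r m) (r n) < e"
        by blast
    qed
    then obtain s where s: "r \<longlonglongrightarrow> s"
      using Cauchy_convergent convergent_def by blast
    have "(\<lambda>n. x n - r n *\<^sub>R v) \<longlonglongrightarrow> l - s *\<^sub>R v"
      by (intro tendsto_intros lim s)
    then have "a \<longlonglongrightarrow> l - s *\<^sub>R v"
      by (simp add: ar)
    then have "l - s *\<^sub>R v \<in> S"
      using assms(1) ar(1) closed_sequentially by blast
    then have "(l - s *\<^sub>R v) + s *\<^sub>R v \<in> S + span {v}"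
      by (intro set_plus_intro) (auto simp: span_singleton)
    then show "l \<in> S + span {v}"
      by simp
  qed
qed

text \<open>
  A complex line is the sum of the two real lines through \<open>v\<close> and \<open>\<i> *\<^sub>C v\<close>, so the real
  case applies twice.
\<close>

lemma closed_csubspace_plus_cspan_singleton:
  assumes "closed_csubspace A"
  shows "closed_csubspace (A + cspan {v})"
proof -
  have "cspan {v} = span {v} + span {\<i> *\<^sub>C v}"
  proof (intro subset_antisym subsetI)
    fix x assume "x \<in> cspan {v}"
    then obtain c where "x = c *\<^sub>C v"
      by (auto simp: complex_vector.span_singleton)
    moreover have "c = complex_of_real (Re c) + complex_of_real (Im c) * \<i>"
      by (simp add: complex_eq_iff)
    ultimately have "x = Re c *\<^sub>R v + Im c *\<^sub>R (\<i> *\<^sub>C v)"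
      by (metis scaleC_add_left scaleC_scaleC scaleR_scaleC)
    then show "x \<in> span {v} + span {\<i> *\<^sub>C v}"
      by (auto simp: span_singleton)
  next
    fix x assume "x \<in> span {v} + span {\<i> *\<^sub>C v}"
    then show "x \<in> cspan {v}"
      by (auto elim!: set_plus_elim simp: span_singleton complex_vector.span_singleton
          scaleR_scaleC scaleC_scaleC simp flip: scaleC_add_left)
  qed
  then have "A + cspan {v} = (A + span {v}) + span {\<i> *\<^sub>C v}"
    by (simp add: add.assoc)
  moreover have "subspace (A + span {v})"
    unfolding plus_eq_Collect using assms
    by (intro subspace_sums) (simp_all add: closed_csubspace_def csubspace_imp_subspace)
  ultimately have "closed (A + cspan {v})"
    using assms by (simp add: closed_plus_span_singleton closed_csubspace_def csubspace_imp_subspace)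
  then show ?thesis
    using assms by (simp add: closed_csubspace_def csubspace_plus)
qed

lemma closed_csubspace_plus_cspan_finite:
  assumes "finite B" "closed_csubspace A"
  shows "closed_csubspace (A + cspan B)"
  using assms
proof (induction B)
  case empty
  then show ?case
    by simp
next
  case (insert b B)
  have "A + cspan (insert b B) = (A + cspan B) + cspan {b}"
    by (simp add: cspan_insert_plus[of b B] ac_simps)
  then show ?case
    using insert by (simp add: closed_csubspace_plus_cspan_singleton)
qed

section \<open>Finite-dimensional quotients\<close>

text \<open>
  This replaces the equality of cosets by the form in which a finite-dimensional quotient
  is used below: a finite set spans \<open>A\<close> modulo \<open>B\<close>.
\<close>

lemma finite_dim_quotientE:
  assumes "finite_dim_quotient A B" "csubspace B"
  obtains F where "finite F" "F \<subseteq> A" "A \<subseteq> B + cspan F"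
proof -
  obtain F where F: "finite F" "F \<subseteq> A"
    and q: "\<And>q. q \<in> quotient_space A B \<Longrightarrow> \<exists>c. q = coset (\<Sum>f\<in>F. c f *\<^sub>C f) B"
    using assms(1) by (auto simp: finite_dim_quotient_def)
  have "A \<subseteq> B + cspan F"
  proof
    fix x assume "x \<in> A"
    then obtain c where "coset x B = coset (\<Sum>f\<in>F. c f *\<^sub>C f) B"
      using q by (auto simp: quotient_space_def)
    moreover have "x \<in> coset x B"
      using complex_vector.subspace_0[OF assms(2)] by (force simp: coset_def)
    ultimately obtain b where "b \<in> B" "x = b + (\<Sum>f\<in>F. c f *\<^sub>C f)"
      by (auto simp: coset_def add.commute)
    moreover have "(\<Sum>f\<in>F. c f *\<^sub>C f) \<in> cspan F"
      by (intro complex_vector.span_sum complex_vector.span_scale complex_vector.span_base)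
    ultimately show "x \<in> B + cspan F"
      by blast
  qed
  then show ?thesis
    using that F by blast
qed

text \<open>
  \<open>W\<close> embeds into the quotient of \<open>A + cspan F\<close> by \<open>A\<close>. A basis is built along \<open>F\<close>: admitting one more
  vector \<open>f\<close> enlarges the part of \<open>W\<close> that is reached by at most one dimension, since any two new
  vectors can be combined so as to cancel \<open>f\<close>.
\<close>

lemma csubspace_finite_basis_if_disjoint:
  assumes "finite F" "csubspace W" "csubspace A" "W \<inter> A = {0}" "W \<subseteq> A + cspan F"
  shows "\<exists>B. finite B \<and> W = cspan B"
  using assms
proof (induction F arbitrary: W)
  case empty
  then have "W = cspan {}"
    by auto
  then show ?case
    by blast
next
  case (insert f F)
  define V where "V = W \<inter> (A + cspan F)"
  have V: "csubspace V"
    unfolding V_def using insert.prems by (simp add: complex_vector.subspace_inter csubspace_plus)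
  have "V \<inter> A = {0}"
    using insert.prems(3) complex_vector.subspace_0[OF V] complex_vector.subspace_0[OF insert.prems(2)]
    by (auto simp: V_def)
  then obtain B where B: "finite B" "V = cspan B"
    using insert.IH[OF V insert.prems(2)] V_def by blast
  show ?case
  proof (cases "W = V")
    case False
    then obtain w where w: "w \<in> W" "w \<notin> A + cspan F"
      by (auto simp: V_def)
    have split: "\<exists>y c. y \<in> A + cspan F \<and> x = y + c *\<^sub>C f" if "x \<in> W" for x
    proof -
      have "x \<in> (A + cspan F) + cspan {f}"
        using that insert.prems(4) by (auto simp: cspan_insert_plus[of f F] ac_simps)
      then show ?thesis
        by (auto elim!: set_plus_elim[of x] simp: complex_vector.span_singleton)
    qed
    obtain y c where y: "y \<in> A + cspan F" "w = y + c *\<^sub>C f"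
      using split w by blast
    \<comment> \<open>Since \<open>w\<close> has a nonzero coefficient at \<open>f\<close>, a multiple of \<open>w\<close> cancels that of any other vector.\<close>
    then have "c \<noteq> 0"
      using w by auto
    have AF: "csubspace (A + cspan F)"
      using insert.prems by (simp add: csubspace_plus)
    have "W \<subseteq> cspan (insert w B)"
    proof
      fix x assume "x \<in> W"
      then obtain y' c' where y': "y' \<in> A + cspan F" "x = y' + c' *\<^sub>C f"
        using split by blast
      have "x - (c' / c) *\<^sub>C w = y' - (c' / c) *\<^sub>C y"
        using \<open>c \<noteq> 0\<close> by (simp add: y y' scaleC_add_right scaleC_scaleC)
      also have "\<dots> \<in> A + cspan F"
        using AF y(1) y'(1) by (intro complex_vector.subspace_diff complex_vector.subspace_scale)
      finally have "x - (c' / c) *\<^sub>C w \<in> A + cspan F" .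
      moreover have "x - (c' / c) *\<^sub>C w \<in> W"
        using w \<open>x \<in> W\<close> insert.prems(1)
        by (intro complex_vector.subspace_diff complex_vector.subspace_scale)
      ultimately have "x - (c' / c) *\<^sub>C w \<in> V"
        by (simp add: V_def)
      then show "x \<in> cspan (insert w B)"
        by (auto simp: complex_vector.span_insert B)
    qed
    moreover have "cspan (insert w B) \<subseteq> W"
    proof (rule complex_vector.span_minimal)
      show "insert w B \<subseteq> W"
        using w B complex_vector.span_superset[of B] by (auto simp: V_def)
    qed (use insert.prems in simp)
    ultimately show ?thesis
      using B by (metis finite_insert subset_antisym)
  qed (use B in blast)
qed

section \<open>Closed complements\<close>

text \<open>
  One complex orthogonality condition amounts to two real ones, whose solution sets are
  closed hyperplanes.
\<close>

lemma closed_csubspace_orthogonal: "closed_csubspace {x. cinner x f = 0}"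
proof -
  have "cinner x (\<i> *\<^sub>C f) = - \<i> * cinner x f" for x
    by (metis cinner_commute cinner_scaleC_left complex_cnj_i complex_cnj_mult)
  then have "inner (\<i> *\<^sub>C f) x = Im (cinner x f)" "inner f x = Re (cinner x f)" for x
    using inner_eq_Re_cinner[of x "\<i> *\<^sub>C f"] inner_eq_Re_cinner[of x f]
    by (simp_all add: inner_commute)
  then have "{x. cinner x f = 0} = {x. inner f x = 0} \<inter> {x. inner (\<i> *\<^sub>C f) x = 0}"
    by (auto simp: complex_eq_iff)
  then have "closed {x. cinner x f = 0}"
    by (simp add: closed_Int closed_hyperplane)
  moreover have "csubspace {x. cinner x f = 0}"
    using cinner_scaleC_left[of 0 0 f]
    by (auto simp: complex_vector.subspace_def cinner_add_left cinner_scaleC_left)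
  ultimately show ?thesis
    by (simp add: closed_csubspace_def)
qed

text \<open>
  To pass from \<open>B\<close> to \<open>insert b B\<close>, let \<open>e\<close> be the component of \<open>b\<close> in the complement \<open>D\<close> found so far
  and shrink \<open>D\<close> to the orthogonal complement of \<open>e\<close> in \<open>D\<close>. Only projections onto a line occur, and
  closedness is preserved since orthogonality to a vector is a closed condition. The resulting
  complement need not be orthogonal to \<open>cspan B\<close>.
\<close>

lemma closed_complement_of_finite_span:
  assumes "finite B" "closed_csubspace E" "B \<subseteq> E"
  shows "\<exists>D. closed_csubspace D \<and> D \<inter> cspan B = {0} \<and> D + cspan B = E"
  using assms
proof (induction B)
  case empty
  then show ?case
    by (intro exI[of _ E]) (auto simp: closed_csubspace_def complex_vector.subspace_0)
next
  case (insert b B)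
  then obtain D where D: "closed_csubspace D" "D \<inter> cspan B = {0}" "D + cspan B = E"
    by auto
  then have D_sub: "csubspace D"
    by (simp add: closed_csubspace_def)
  obtain e s where es: "e \<in> D" "s \<in> cspan B" "b = e + s"
    using insert.prems D by (auto elim: set_plus_elim)
  have "cspan (insert b B) = cspan (insert e B)"
  proof (rule complex_vector.eq_span_insert_eq)
    show "b - e \<in> cspan B"
      using es by simp
  qed
  then have span_eq: "cspan (insert b B) = cspan {e} + cspan B"
    by (simp only: cspan_insert_plus[of e B])
  show ?case
  proof (cases "e = 0")
    case True
    then show ?thesis
      using D span_eq by auto
  next
    case False
    define D' where "D' = D \<inter> {x. cinner x e = 0}"
    have ee: "cinner e e \<noteq> 0"
      using False inner_eq_Re_cinner[of e e] by auto
    have D': "closed_csubspace D'"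
      unfolding D'_def using D closed_csubspace_orthogonal[of e]
      by (auto simp: closed_csubspace_def complex_vector.subspace_inter)
    have "D' + cspan {e} = D"
    proof (intro subset_antisym subsetI)
      fix x assume "x \<in> D"
      define c where "c = cinner x e / cinner e e"
      have "cinner (x - c *\<^sub>C e) e = cinner x e - c * cinner e e"
        by (metis add_diff_cancel_right' cinner_add_left cinner_scaleC_left diff_add_cancel)
      then have "x - c *\<^sub>C e \<in> D'"
        using \<open>x \<in> D\<close> es ee D_sub
        by (simp add: D'_def c_def complex_vector.subspace_diff complex_vector.subspace_scale)
      then have "(x - c *\<^sub>C e) + c *\<^sub>C e \<in> D' + cspan {e}"
        by (intro set_plus_intro) (auto simp: complex_vector.span_singleton)
      then show "x \<in> D' + cspan {e}"
        by simp
    next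
      fix x assume "x \<in> D' + cspan {e}"
      then show "x \<in> D"
        using D_sub es by (auto elim!: set_plus_elim simp: D'_def complex_vector.span_singleton
            complex_vector.subspace_add complex_vector.subspace_scale)
    qed
    then have "D' + cspan (insert b B) = E"
      using D(3) by (simp add: span_eq flip: add.assoc)
    moreover have "x = 0" if x: "x \<in> D'" "x \<in> cspan (insert b B)" for x
    proof -
      obtain c t where ct: "t \<in> cspan B" "x = c *\<^sub>C e + t"
        using x(2) by (auto simp: span_eq complex_vector.span_singleton elim!: set_plus_elim)
      then have "t = x - c *\<^sub>C e"
        by simp
      then have "t \<in> D"
        using x(1) es D_sub
        by (simp add: D'_def complex_vector.subspace_diff complex_vector.subspace_scale)
      then have "t = 0"
        using ct D by blast
      then have "c * cinner e e = 0"
        using x(1) ct by (simp add: D'_def cinner_scaleC_left)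
      then show ?thesis
        using ee ct \<open>t = 0\<close> by simp
    qed
    then have "D' \<inter> cspan (insert b B) = {0}"
      using D' by (auto simp: closed_csubspace_def complex_vector.subspace_0 complex_vector.span_zero)
    ultimately show ?thesis
      using D' by blast
  qed
qed

text \<open>
  Up to the part of \<open>Q\<close> outside \<open>A + cspan G\<close>, this is a complement of \<open>Q\<close> containing \<open>A\<close>. It is found
  greedily: a vector of \<open>G\<close> is added to \<open>W\<close> exactly when \<open>W + Q\<close> does not contain it yet, which is what
  keeps \<open>W\<close> disjoint from \<open>Q\<close>. Asking for \<open>W \<subseteq> A + cspan G\<close> lets the choice of \<open>G\<close> confine \<open>W\<close> to a
  prescribed subspace.
\<close>

lemma closed_complement_above:
  assumes "finite G" "closed_csubspace A" "csubspace Q" "A \<inter> Q = {0}"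
  shows "\<exists>W. closed_csubspace W \<and> A \<subseteq> W \<and> W \<subseteq> A + cspan G \<and> W \<inter> Q = {0} \<and> A + cspan G \<subseteq> W + Q"
  using assms(1)
proof (induction G)
  case empty
  then show ?case
    using assms subset_plus_left[of Q A] by (intro exI[of _ A]) simp
next
  case (insert g G)
  then obtain W where W: "closed_csubspace W" "A \<subseteq> W" "W \<subseteq> A + cspan G" "W \<inter> Q = {0}"
      "A + cspan G \<subseteq> W + Q"
    by auto
  then have W_sub: "csubspace W"
    by (simp add: closed_csubspace_def)
  have eq: "A + cspan (insert g G) = (A + cspan G) + cspan {g}"
    by (simp add: cspan_insert_plus[of g G] ac_simps)
  show ?case
  proof (cases "g \<in> W + Q")
    case True
    have WQ: "csubspace (W + Q)"
      using W_sub assms(3) by (rule csubspace_plus)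
    have "A + cspan (insert g G) \<subseteq> W + Q"
      unfolding eq using True
      by (intro plus_subset_csubspace[OF W(5) complex_vector.span_minimal WQ] WQ) simp
    moreover have "W \<subseteq> A + cspan (insert g G)"
      unfolding eq by (rule subset_trans[OF W(3) subset_plus_left]) simp
    ultimately show ?thesis
      using W by blast
  next
    case False
    have x0: "x = 0" if x: "x \<in> W + cspan {g}" "x \<in> Q" for x
    proof -
      obtain w c where wc: "w \<in> W" "x = w + c *\<^sub>C g"
        using x(1) by (auto simp: complex_vector.span_singleton elim!: set_plus_elim)
      have "c = 0"
      proof (rule ccontr)
        assume "c \<noteq> 0"
        have "g = inverse c *\<^sub>C (x - w)"
          using \<open>c \<noteq> 0\<close> by (simp add: wc scaleC_scaleC)
        also have "\<dots> = - (inverse c *\<^sub>C w) + inverse c *\<^sub>C x"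
          by (simp add: complex_vector.scale_right_diff_distrib)
        also have "\<dots> \<in> W + Q"
          using wc x W_sub assms(3)
          by (intro set_plus_intro complex_vector.subspace_neg complex_vector.subspace_scale)
        finally show False
          using False by blast
      qed
      then show ?thesis
        using wc x W by auto
    qed
    show ?thesis
    proof (intro exI[of _ "W + cspan {g}"] conjI)
      show "closed_csubspace (W + cspan {g})"
        using W(1) by (rule closed_csubspace_plus_cspan_singleton)
      show "A \<subseteq> W + cspan {g}"
        by (rule subset_trans[OF W(2) subset_plus_left]) simp
      show "W + cspan {g} \<subseteq> A + cspan (insert g G)"
        unfolding eq by (rule set_plus_mono2[OF W(3) subset_refl])
      have "csubspace (W + cspan {g})"
        using W_sub by (simp add: csubspace_plus)
      then show "(W + cspan {g}) \<inter> Q = {0}"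
        using x0 complex_vector.subspace_0[of "W + cspan {g}"] complex_vector.subspace_0[OF assms(3)]
        by blast
      have "A + cspan (insert g G) \<subseteq> (W + Q) + cspan {g}"
        unfolding eq by (rule set_plus_mono2[OF W(5) subset_refl])
      then show "A + cspan (insert g G) \<subseteq> (W + cspan {g}) + Q"
        by (simp add: ac_simps)
    qed
  qed
qed

section \<open>Splitting off the distributive part\<close>

theorem proposition5p2:
  fixes E1 E2 E3 :: "'a::complex_hilbert_space set"
  assumes "three_subspaces UNIV E1 E2 E3"
    and "E1 \<inter> E2 = {0}"
    and "closed_sum E1 E2 = UNIV"
    and "E2 \<subset> E3"
    and "finite_dim_quotient E3 E2"
  shows "(E3 \<noteq> E3 \<inter> (E1 + E2) \<longrightarrow>
      (\<exists>E1' E2' E3' N2.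
        closed_csubspace E1' \<and> closed_csubspace E2' \<and> closed_csubspace E3' \<and>
        closed_csubspace N2 \<and>
        alg_independent [E1', E3', N2] \<and> closure (E1' + E3' + N2) = UNIV \<and>
        pentagon (closed_sum E1' E3') E1' E2' E3' \<and>
        alg_independent [E1', N2] \<and> E1 = closure (E1' + N2) \<and>
        E2 = E2' \<and>
        alg_independent [E3', N2] \<and> E3 = closure (E3' + N2) \<and>
        distributive_part N2 N2 {0} N2)) \<and>
    (E3 = E3 \<inter> (E1 + E2) \<longrightarrow>
      (\<exists>N1 N2 M1.
        closed_csubspace N1 \<and> closed_csubspace N2 \<and> closed_csubspace M1 \<and>
        alg_independent [N1, N2, M1] \<and> closure (N1 + N2 + M1) = UNIV \<and>
        E1 = N2 + M1 \<and> E2 = N1 \<and> E3 = N1 + N2))"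
proof -
  have closed: "closed_csubspace E1" "closed_csubspace E2" "closed_csubspace E3"
    using assms(1) by (auto simp: three_subspaces_def)
  then have sub: "csubspace E1" "csubspace E2" "csubspace E3" and
    closure_E: "closure E1 = E1" "closure E2 = E2" "closure E3 = E3"
    by (auto simp: closed_csubspace_def)
  obtain F where F: "finite F" "F \<subseteq> E3" "E3 \<subseteq> E2 + cspan F"
    using finite_dim_quotientE[OF assms(5) sub(2)] .
  define N where "N = E1 \<inter> E3"
  have N: "closed_csubspace N"
    unfolding N_def using closed by (auto simp: closed_csubspace_def complex_vector.subspace_inter)
  then have N_sub: "csubspace N"
    by (simp add: closed_csubspace_def)
  have "N \<inter> E2 = {0}"
    using assms(2,4) by (auto simp: N_def)
  moreover have "N \<subseteq> E2 + cspan F"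
    using F(3) by (auto simp: N_def)
  ultimately obtain B where B: "finite B" "N = cspan B"
    using csubspace_finite_basis_if_disjoint[OF F(1) N_sub sub(2)] by blast
  have "B \<subseteq> E1"
    using B complex_vector.span_superset[of B] by (auto simp: N_def)
  then obtain D where D: "closed_csubspace D" "D \<inter> N = {0}" "D + N = E1"
    using closed_complement_of_finite_span[OF B(1) closed(1)] B(2) by blast
  have D_sub: "csubspace D"
    using D by (simp add: closed_csubspace_def)
  have "D \<subseteq> E1"
    using D(3) subset_plus_left[OF N_sub, of D] by simp

  \<comment> \<open>The modular law: subtracting the \<open>E2\<close>-component of a vector of \<open>E3\<close> leaves a vector of \<open>N\<close>.\<close>
  have part_ii: "\<exists>N1 N2 M1.
      closed_csubspace N1 \<and> closed_csubspace N2 \<and> closed_csubspace M1 \<and>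
      alg_independent [N1, N2, M1] \<and> closure (N1 + N2 + M1) = UNIV \<and>
      E1 = N2 + M1 \<and> E2 = N1 \<and> E3 = N1 + N2" if le: "E3 \<subseteq> E1 + E2"
  proof (intro exI conjI)
    show "E1 = N + D"
      using D(3) by (simp add: add.commute)
    have "E2 + N + D = E1 + E2"
      unfolding D(3)[symmetric] by (simp add: ac_simps)
    then show "closure (E2 + N + D) = UNIV"
      using assms(3) by (simp add: closed_sum_def)
    show "E3 = E2 + N"
    proof
      show "E2 + N \<subseteq> E3"
        using assms(4) sub by (intro plus_subset_csubspace) (auto simp: N_def)
      show "E3 \<subseteq> E2 + N"
      proof
        fix x assume x: "x \<in> E3"
        then obtain a b where ab: "a \<in> E1" "b \<in> E2" "x = a + b"
          using le by (blast elim: set_plus_elim)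
        then have "x - b \<in> E3"
          using x assms(4) sub(3) by (blast intro: complex_vector.subspace_diff)
        then have "a \<in> N"
          using ab by (simp add: N_def)
        then show "x \<in> E2 + N"
          using ab by (auto simp: add.commute[of a])
      qed
    qed
    show "alg_independent [E2, N, D]"
    proof (rule alg_independent_tripleI)
      fix a b c assume abc: "a \<in> E2" "b \<in> N" "c \<in> D" "a + b + c = 0"
      then have "b + c \<in> E1"
        using D(3) by (auto simp: add.commute[of b])
      moreover have "b + c = - a"
        using abc(4) by (simp add: eq_neg_iff_add_eq_0 ac_simps)
      then have "b + c \<in> E2"
        using abc(1) sub by (simp add: complex_vector.subspace_neg)
      ultimately have "b + c = 0"
        using assms(2) by blast
      then have "c = - b"
        by (simp add: eq_neg_iff_add_eq_0 add.commute)
      then have "c \<in> D \<inter> N"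
        using abc(2,3) N_sub by (simp add: complex_vector.subspace_neg)
      then have "c = 0"
        using D(2) by blast
      then show "a = 0 \<and> b = 0 \<and> c = 0"
        using abc(4) \<open>b + c = 0\<close> by simp
    qed
  qed (use closed N D in auto)

  have part_i: "\<exists>E1' E2' E3' N2.
      closed_csubspace E1' \<and> closed_csubspace E2' \<and> closed_csubspace E3' \<and>
      closed_csubspace N2 \<and>
      alg_independent [E1', E3', N2] \<and> closure (E1' + E3' + N2) = UNIV \<and>
      pentagon (closed_sum E1' E3') E1' E2' E3' \<and>
      alg_independent [E1', N2] \<and> E1 = closure (E1' + N2) \<and>
      E2 = E2' \<and>
      alg_independent [E3', N2] \<and> E3 = closure (E3' + N2) \<and>
      distributive_part N2 N2 {0} N2" if not_le: "\<not> E3 \<subseteq> E1 + E2"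
  proof -
    define K where "K = closed_sum D E2"
    have K: "closed_csubspace K"
      unfolding K_def closed_sum_def using D_sub sub by (simp add: closed_csubspace_closure csubspace_plus)
    then have K_sub: "csubspace K" and K_closed: "closed K"
      by (auto simp: closed_csubspace_def)
    have "D + E2 \<subseteq> K"
      unfolding K_def closed_sum_def by (rule closure_subset)
    then have DK: "D \<subseteq> K" and E2K: "E2 \<subseteq> K"
      using subset_trans[OF subset_plus_left[OF sub(2), of D]]
        subset_trans[OF subset_plus_right[OF D_sub, of E2]] by simp_all
    have "E1 + E2 \<subseteq> K + N"
    proof -
      have "E1 + E2 = (D + E2) + N"
        unfolding D(3)[symmetric] by (simp add: ac_simps)
      then show ?thesis
        using \<open>D + E2 \<subseteq> K\<close> set_plus_mono2[of "D + E2" K N N] by simp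
    qed
    moreover have "closed (K + N)"
      using closed_csubspace_plus_cspan_finite[OF B(1) K] B(2) by (simp add: closed_csubspace_def)
    ultimately have KN: "K + N = UNIV"
      using closure_minimal[of "E1 + E2" "K + N"] assms(3)
      by (simp add: closed_sum_def top.extremum_unique)
    \<comment> \<open>Every vector can be shifted into \<open>K\<close> by a vector of \<open>N\<close>; doing this to the vectors of \<open>F\<close>
      yields a spanning set of \<open>E3\<close> modulo \<open>E2 + N\<close> inside \<open>K\<close>.\<close>
    have "\<exists>k n. k \<in> K \<and> n \<in> N \<and> f = k + n" for f
      using KN set_plus_elim[of f K N] by blast
    then obtain k n where kn: "\<And>f. k f \<in> K" "\<And>f. n f \<in> N" "\<And>f. f = k f + n f"
      by metis
    have "k f \<in> E3" if "f \<in> F" for f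
    proof -
      have "f - n f \<in> E3"
        using that F(2) kn(2)[of f] sub(3) by (intro complex_vector.subspace_diff) (auto simp: N_def)
      then show ?thesis
        using kn(3)[of f] by (metis add_diff_cancel_right')
    qed
    then have kF: "finite (k ` F)" "k ` F \<subseteq> E3" "k ` F \<subseteq> K"
      using F(1) kn(1) by auto
    obtain W where W: "closed_csubspace W" "E2 \<subseteq> W" "W \<subseteq> E2 + cspan (k ` F)" "W \<inter> N = {0}"
        "E2 + cspan (k ` F) \<subseteq> W + N"
      using closed_complement_above[OF kF(1) closed(2) N_sub] \<open>N \<inter> E2 = {0}\<close> by blast
    then have W_sub: "csubspace W" and WN_sub: "csubspace (W + N)"
      using N_sub by (auto simp: closed_csubspace_def csubspace_plus)
    have "W \<subseteq> K"
      by (rule subset_trans[OF W(3) plus_subset_csubspace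
            [OF E2K complex_vector.span_minimal[OF kF(3) K_sub] K_sub]])
    have "E2 \<subseteq> E3"
      using assms(4) by blast
    then have "W \<subseteq> E3"
      by (rule subset_trans[OF W(3) plus_subset_csubspace
            [OF _ complex_vector.span_minimal[OF kF(2) sub(3)] sub(3)]])
    have WN: "W + N = E3"
    proof
      show "W + N \<subseteq> E3"
        using \<open>W \<subseteq> E3\<close> sub by (intro plus_subset_csubspace) (auto simp: N_def)
      have "F \<subseteq> W + N"
      proof
        fix f assume "f \<in> F"
        then have "k f \<in> cspan (k ` F)"
          by (simp add: complex_vector.span_base)
        then have "k f \<in> W + N"
          using W(5) subset_plus_right[OF sub(2)] by (meson subsetD)
        moreover have "n f \<in> W + N"
          using kn(2) subset_plus_right[OF W_sub] by (meson subsetD)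
        ultimately show "f \<in> W + N"
          using kn(3)[of f] complex_vector.subspace_add[OF WN_sub] by metis
      qed
      moreover have "E2 \<subseteq> W + N"
        by (rule subset_trans[OF W(2) subset_plus_left[OF N_sub]])
      ultimately have "E2 + cspan F \<subseteq> W + N"
        using WN_sub by (intro plus_subset_csubspace complex_vector.span_minimal)
      then show "E3 \<subseteq> W + N"
        by (rule subset_trans[OF F(3)])
    qed
    have K_eq: "closed_sum D W = K"
    proof
      show "closed_sum D W \<subseteq> K"
        unfolding closed_sum_def using DK \<open>W \<subseteq> K\<close> K_sub K_closed
        by (intro closure_minimal plus_subset_csubspace)
      show "K \<subseteq> closed_sum D W"
        unfolding K_def closed_sum_def using W(2) by (intro closure_mono set_plus_mono2) auto
    qed
    have "D \<inter> E3 = {0}"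
      using D(2) \<open>D \<subseteq> E1\<close> complex_vector.subspace_0[OF D_sub] complex_vector.subspace_0[OF sub(3)]
      by (auto simp: N_def)
    have "W \<noteq> E2"
    proof
      assume "W = E2"
      then have "E3 \<subseteq> E2 + E1"
        using WN set_plus_mono2[of E2 E2 N E1] by (auto simp: N_def)
      then show False
        using not_le by (simp add: add.commute)
    qed
    \<comment> \<open>Both nontriviality facts rest on \<open>E1 + E2\<close> not being the whole space: this sum would be closed,
      hence everything, if \<open>E2\<close> were \<open>0\<close> or if \<open>E1\<close> were the finite-dimensional \<open>N\<close>.\<close>
    have "E1 \<noteq> UNIV"
      using not_le subset_plus_left[OF sub(2), of E1] by (metis subset_UNIV subset_trans)
    then have "E2 \<noteq> {0}"
      using assms(3) closure_E by (auto simp: closed_sum_def)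
    have "D \<noteq> {0}"
    proof
      assume "D = {0}"
      then have "E1 = cspan B"
        using D(3) B(2) by simp
      then have "closed (E2 + E1)"
        using closed_csubspace_plus_cspan_finite[OF B(1) closed(2)] by (simp add: closed_csubspace_def)
      then have "E1 + E2 = UNIV"
        using assms(3) closure_closed by (auto simp: closed_sum_def add.commute)
      then show False
        using not_le by simp
    qed
    have pent: "pentagon K D E2 W"
      unfolding pentagon_def three_subspaces_def
    proof (intro conjI)
      show "D \<inter> W = {0}"
        using \<open>D \<inter> E3 = {0}\<close> \<open>W \<subseteq> E3\<close> complex_vector.subspace_0[OF W_sub] by blast
      show "D \<noteq> K"
        using E2K \<open>D \<subseteq> E1\<close> assms(2) \<open>E2 \<noteq> {0}\<close> by blast
      show "E2 \<noteq> K"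
        using \<open>W \<subseteq> K\<close> W(2) \<open>W \<noteq> E2\<close> by blast
      show "W \<noteq> K"
        using DK \<open>D \<inter> E3 = {0}\<close> \<open>W \<subseteq> E3\<close> \<open>D \<noteq> {0}\<close> by blast
      show "W \<noteq> {0}"
        using W(2) \<open>E2 \<noteq> {0}\<close> complex_vector.subspace_0[OF sub(2)] by blast
    qed (use K_def K D(1) closed(2) W(1,2) DK E2K \<open>W \<subseteq> K\<close> \<open>W \<noteq> E2\<close> \<open>E2 \<noteq> {0}\<close> \<open>D \<noteq> {0}\<close> in auto)
    have indep3: "alg_independent [D, W, N]"
    proof (rule alg_independent_tripleI)
      fix a b c assume abc: "a \<in> D" "b \<in> W" "c \<in> N" "a + b + c = 0"
      have "b + c \<in> E3"
        using abc(2,3) WN set_plus_intro by blast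
      moreover have "b + c = - a"
        using abc(4) by (simp add: eq_neg_iff_add_eq_0 ac_simps)
      ultimately have "b + c \<in> D \<inter> E3"
        using abc(1) D_sub by (simp add: complex_vector.subspace_neg)
      then have "b + c = 0"
        using \<open>D \<inter> E3 = {0}\<close> by blast
      then have "b = - c"
        by (simp add: eq_neg_iff_add_eq_0)
      then have "b \<in> W \<inter> N"
        using abc(2,3) N_sub by (simp add: complex_vector.subspace_neg)
      then have "b = 0"
        using W(4) by blast
      then show "a = 0 \<and> b = 0 \<and> c = 0"
        using abc(4) \<open>b + c = 0\<close> by simp
    qed
    have dense: "closure (D + W + N) = UNIV"
    proof -
      have "E1 + E2 \<subseteq> E1 + W"
        using W(2) by (intro set_plus_mono2) auto
      also have "E1 + W = D + W + N"
        unfolding D(3)[symmetric] by (simp add: ac_simps)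
      finally show ?thesis
        using closure_mono[of "E1 + E2" "D + W + N"] assms(3) by (simp add: closed_sum_def top.extremum_unique)
    qed
    have "alg_independent [D, N]" "alg_independent [W, N]"
      using D(2) W(4) N_sub by (simp_all add: alg_independent_pairI)
    then show ?thesis
      using closed D(1) W(1) N indep3 dense pent K_eq D(3) WN closure_E
      by (intro exI[of _ D] exI[of _ E2] exI[of _ W] exI[of _ N] conjI distributive_part_N2_only) simp_all
  qed
  show ?thesis
    using part_i part_ii by blast
qed

end
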